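(* Let $(\Omega,\mathcal{F},\mathrm{p})$ be a probability space and let $\omega\mapsto M(\omega)$ be a measurable map on $\Omega$ taking values in the set of $d\times d$ stochastic matrices. Suppose that $\mathrm{p}(M(\omega)\in\mathcal{P}_E)>0$, where $\mathcal{P}_E$ denotes the set of stochastic matrices with strictly positive entries. Then there exist $\alpha>0$, a set $\Omega_4\subset\Omega^{\mathbb{N}^*}$ with $\mathbb{P}(\Omega_4)=1$, and a vector-valued random variable $\eta_\infty$ on $\Omega^{\mathbb{N}^*}$ such that for all $\overline\omega=(\omega_j)_{j\ge1}\in\Omega_4$, $$\Phi_n(\overline\omega):=M(\omega_n)M(\omega_{n-1})\cdots M(\omega_1)=|\psi_{\mathcal S}\rangle\langle\eta_\infty(\overline\omega)|+O_{\overline\omega}(e^{-\alpha n}),$$ where $\psi_{\mathcal S}=\frac1{\sqrt d}(1,1,\dots,1)^T$ and where the remainder depends on $\overline\omega$ (i.e. for each $\overline\omega\in\Omega_4$ there is a constant $C_{\overline\omega}$ such that its norm is at most $C_{\overline\omega}e^{-\alpha n}$ for all $n\ge 1$).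
   Context: A stochastic matrix is a matrix with non-negative entries each of whose rows sums to $1$. $\mathbb{N}^*=\{1,2,\dots\}$ and $\mathbb{P}=\prod_{j\ge1}\mathrm{p}$ is the product probability measure on $\Omega^{\mathbb{N}^*}$. $|\psi\rangle\langle\phi|$ denotes the rank-one operator $\chi\mapsto\langle\phi,\chi\rangle\psi$ on $\mathbb{C}^d$ (inner product linear in the second factor). *)

theory Defs
  imports "HOL-Probability.Probability" "HOL-Library.Complex_Order"
begin

text \<open>Matrices act on \<open>\<complex>\<^sup>d\<close>, so entries have type \<^typ>\<open>complex\<close>.  In the order of
  \<^theory>\<open>HOL-Library.Complex_Order\<close>, \<open>0 \<le> z\<close> means that \<open>z\<close> is real and non-negative, and
  \<open>0 < z\<close> that it is real and positive.\<close>

definition stochastic_matrices :: "(complex^'d^'d) set" where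
  "stochastic_matrices = {A. (\<forall>i j. 0 \<le> A $ i $ j) \<and> (\<forall>i. (\<Sum>j\<in>UNIV. A $ i $ j) = 1)}"

definition positive_stochastic_matrices :: "(complex^'d^'d) set" where
  "positive_stochastic_matrices = {A \<in> stochastic_matrices. \<forall>i j. 0 < A $ i $ j}"

text \<open>The library's inner product \<open>\<bullet>\<close> on \<open>\<complex>\<^sup>d\<close> is the real one, i.e. the real part of this one.\<close>

definition hermitian_inner :: "complex^'d \<Rightarrow> complex^'d \<Rightarrow> complex" where
  "hermitian_inner \<phi> v = (\<Sum>i\<in>UNIV. cnj (\<phi> $ i) * v $ i)"

definition ketbra :: "complex^'d \<Rightarrow> complex^'d \<Rightarrow> complex^'d \<Rightarrow> complex^'d" where
  "ketbra \<psi> \<phi> = (\<lambda>v. hermitian_inner \<phi> v *s \<psi>)"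

definition psi_S :: "complex^'d" where
  "psi_S = (\<chi> i. of_real (1 / sqrt (real CARD('d))))"

primrec matrix_product :: "('w \<Rightarrow> complex^'d^'d) \<Rightarrow> nat \<Rightarrow> (nat \<Rightarrow> 'w) \<Rightarrow> complex^'d^'d" where
  "matrix_product M 0 \<omega> = mat 1"
| "matrix_product M (Suc n) \<omega> = M (\<omega> (Suc n)) ** matrix_product M n \<omega>"

text \<open>The points of this space are the sequences indexed by \<open>{1..}\<close>; as functions on
  \<^typ>\<open>nat\<close> they take the value \<^term>\<open>undefined\<close> at \<open>0\<close>.\<close>

definition iid_sequence_space :: "'w measure \<Rightarrow> (nat \<Rightarrow> 'w) measure" where
  "iid_sequence_space p = (\<Pi>\<^sub>M j\<in>{1..}. p)"

end

theory Submission
  imports Defs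
begin

text \<open>
  Multiplying on the left by a stochastic matrix replaces every entry of a column by a weighted
  average of that column, so column minima increase, column maxima decrease, and their difference
  shrinks at least by the factor \<open>1 - m\<close>, where \<open>m\<close> is the smallest entry of the matrix. Hence the
  columns of \<open>\<Phi>\<^sub>n\<close> converge to constant columns with an error of at most the product of the first
  \<open>n\<close> factors. By independence this product has expectation \<open>\<rho>^n\<close> with \<open>\<rho> = E(1 - m) < 1\<close>. So
  for \<open>\<beta> > 1\<close> with \<open>\<beta> \<rho> < 1\<close> the series of the products weighted by \<open>\<beta>^n\<close> has finite
  expectation; almost surely its terms are bounded, which is the exponential rate. No law of large
  numbers is needed.
\<close>

subsection \<open>Stochastic matrices\<close>

text \<open>The difference between \<open>hi\<close> and the average is a sum of non-negative terms,
  and an index where \<open>v\<close> attains its minimum alone contributes at least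
  \<open>m * (hi - lo)\<close>. Sharpening the upper side is enough to shrink the spread by the
  factor \<open>1 - m\<close>.\<close>

lemma weighted_average_bounds:
  fixes w v :: "'d::finite \<Rightarrow> real"
  assumes w: "\<And>j. m \<le> w j" "0 \<le> m" "sum w UNIV = 1"
  defines "lo \<equiv> Min (range v)" and "hi \<equiv> Max (range v)"
  shows "lo \<le> (\<Sum>j\<in>UNIV. w j * v j)"
    and "(\<Sum>j\<in>UNIV. w j * v j) \<le> hi - m * (hi - lo)"
proof -
  have v: "lo \<le> v j" "v j \<le> hi" for j
    by (simp_all add: lo_def hi_def)
  have w0: "0 \<le> w j" for j
    using w(1)[of j] w(2) by linarith
  have avg: "(\<Sum>j\<in>UNIV. w j * c) = c" for c
    using w(3) by (simp flip: sum_distrib_right)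
  have "(\<Sum>j\<in>UNIV. w j * lo) \<le> (\<Sum>j\<in>UNIV. w j * v j)"
    by (intro sum_mono mult_left_mono v w0)
  then show "lo \<le> (\<Sum>j\<in>UNIV. w j * v j)"
    by (simp add: avg)
  have "lo \<in> range v"
    unfolding lo_def by (rule Min_in) auto
  then obtain k where k: "v k = lo"
    by auto
  have "m * (hi - lo) \<le> w k * (hi - v k)"
    using w(1)[of k] v[of k] k by (intro mult_mono) (auto intro: w0)
  also have "\<dots> \<le> (\<Sum>j\<in>UNIV. w j * (hi - v j))"
    by (rule member_le_sum) (auto simp: w0 v)
  also have "\<dots> = hi - (\<Sum>j\<in>UNIV. w j * v j)"
    by (simp add: right_diff_distrib sum_subtractf avg)
  finally show "(\<Sum>j\<in>UNIV. w j * v j) \<le> hi - m * (hi - lo)"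
    by linarith
qed

lemma stochastic_matrixD:
  fixes A :: "complex^'d^'d"
  assumes "A \<in> stochastic_matrices"
  shows "0 \<le> Re (A $ i $ j)" "Im (A $ i $ j) = 0" "(\<Sum>j\<in>UNIV. Re (A $ i $ j)) = 1"
proof -
  have "0 \<le> A $ i $ j" and sum: "(\<Sum>j\<in>UNIV. A $ i $ j) = 1"
    using assms by (auto simp: stochastic_matrices_def)
  then show "0 \<le> Re (A $ i $ j)" "Im (A $ i $ j) = 0"
    by (auto simp: less_eq_complex_def)
  show "(\<Sum>j\<in>UNIV. Re (A $ i $ j)) = 1"
    using arg_cong[OF sum, of Re] by simp
qed

lemma mat_1_stochastic: "mat 1 \<in> stochastic_matrices"
  by (auto simp: stochastic_matrices_def mat_def less_eq_complex_def)

lemma matrix_mult_stochastic: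
  fixes A B :: "complex^'d^'d"
  assumes "A \<in> stochastic_matrices" "B \<in> stochastic_matrices"
  shows "A ** B \<in> stochastic_matrices"
proof -
  have "0 \<le> (A ** B) $ i $ j" for i j
    using assms
    by (auto simp: stochastic_matrices_def matrix_matrix_mult_def intro!: sum_nonneg mult_nonneg_nonneg)
  moreover have "(\<Sum>j\<in>UNIV. (A ** B) $ i $ j) = 1" for i
  proof -
    have "(\<Sum>j\<in>UNIV. (A ** B) $ i $ j) = (\<Sum>k\<in>UNIV. A $ i $ k * (\<Sum>j\<in>UNIV. B $ k $ j))"
      by (simp add: matrix_matrix_mult_def sum_distrib_left) (rule sum.swap)
    then show ?thesis
      using assms by (simp add: stochastic_matrices_def)
  qed
  ultimately show ?thesis
    by (simp add: stochastic_matrices_def)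
qed

text \<open>Real parts are taken because \<open>Min\<close> needs a linear order. For stochastic
  matrices this loses nothing, as the imaginary parts vanish.\<close>

definition min_entry :: "complex^'d^'d \<Rightarrow> real" where
  "min_entry A = Min ((\<lambda>(i, j). Re (A $ i $ j)) ` UNIV)"

definition col_min :: "complex^'d^'d \<Rightarrow> 'd \<Rightarrow> real" where
  "col_min A j = Min (range (\<lambda>i. Re (A $ i $ j)))"

definition col_max :: "complex^'d^'d \<Rightarrow> 'd \<Rightarrow> real" where
  "col_max A j = Max (range (\<lambda>i. Re (A $ i $ j)))"

lemma min_entry_le: "min_entry A \<le> Re (A $ i $ j)"
  unfolding min_entry_def by (rule Min_le) (auto intro: image_eqI[of _ _ "(i, j)"])

lemma col_bounds: "col_min A j \<le> Re (A $ i $ j)" "Re (A $ i $ j) \<le> col_max A j"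
  by (simp_all add: col_min_def col_max_def)

lemma col_min_le_col_max: "col_min A j \<le> col_max A j"
  using col_bounds order_trans by blast

lemma stochastic_entry_le_1:
  assumes "A \<in> stochastic_matrices"
  shows "Re (A $ i $ j) \<le> 1"
proof -
  have "Re (A $ i $ j) \<le> (\<Sum>j\<in>UNIV. Re (A $ i $ j))"
    by (rule member_le_sum) (auto simp: stochastic_matrixD[OF assms])
  then show ?thesis
    by (simp add: stochastic_matrixD[OF assms])
qed

lemma min_entry_stochastic:
  assumes "A \<in> stochastic_matrices"
  shows "0 \<le> min_entry A" "min_entry A \<le> 1"
proof -
  show "0 \<le> min_entry A"
    unfolding min_entry_def by (subst Min_ge_iff) (auto simp: stochastic_matrixD[OF assms])
  show "min_entry A \<le> 1"
    using min_entry_le stochastic_entry_le_1[OF assms] by (rule order_trans)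
qed

lemma min_entry_positive:
  assumes "A \<in> positive_stochastic_matrices"
  shows "0 < min_entry A"
  using assms unfolding min_entry_def positive_stochastic_matrices_def
  by (subst Min_gr_iff) (auto simp: less_complex_def)

lemma col_spread_mat_1: "col_max (mat 1) j - col_min (mat 1) j \<le> 1"
proof -
  have "col_max (mat 1) j \<le> 1"
    unfolding col_max_def by (subst Max_le_iff) (auto simp: stochastic_entry_le_1 mat_1_stochastic)
  moreover have "0 \<le> col_min (mat 1) j"
    unfolding col_min_def by (subst Min_ge_iff) (auto simp: stochastic_matrixD mat_1_stochastic)
  ultimately show ?thesis
    by linarith
qed

lemma col_mult_stochastic:
  fixes A B :: "complex^'d^'d"
  assumes A: "A \<in> stochastic_matrices"
  shows "col_min B j \<le> col_min (A ** B) j"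
    and "col_max (A ** B) j \<le> col_max B j - min_entry A * (col_max B j - col_min B j)"
proof -
  have Re: "Re ((A ** B) $ i $ j) = (\<Sum>k\<in>UNIV. Re (A $ i $ k) * Re (B $ k $ j))" for i
    by (simp add: matrix_matrix_mult_def stochastic_matrixD[OF A])
  \<comment> \<open>Row \<open>i\<close> of \<open>A\<close> supplies the weights, column
    \<open>j\<close> of \<open>B\<close> the values.\<close>
  note avg = weighted_average_bounds[of "min_entry A" "\<lambda>k. Re (A $ i $ k)" "\<lambda>k. Re (B $ k $ j)" for i,
      OF min_entry_le min_entry_stochastic(1)[OF A] stochastic_matrixD(3)[OF A],
      folded col_min_def col_max_def Re]
  show "col_min B j \<le> col_min (A ** B) j"
    unfolding col_min_def[of "A ** B"] by (subst Min_ge_iff) (auto simp: avg(1))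
  show "col_max (A ** B) j \<le> col_max B j - min_entry A * (col_max B j - col_min B j)"
    unfolding col_max_def[of "A ** B"] by (subst Max_le_iff) (auto simp: avg(2))
qed

subsection \<open>Convergence of the columns\<close>

text \<open>The column minima increase and are bounded for stochastic factors, so this supremum is
  their limit. As a countable supremum it is also easily seen to be measurable in the
  sequence.\<close>

definition limit_row :: "('w \<Rightarrow> complex^'d^'d) \<Rightarrow> (nat \<Rightarrow> 'w) \<Rightarrow> 'd \<Rightarrow> real" where
  "limit_row M \<omega> j = (SUP n. col_min (matrix_product M n \<omega>) j)"

text \<open>Everything up to the bound on the operator norm is deterministic, for one fixed
  sequence. Indices start at 1 because points of the sequence space are \<open>undefined\<close> at
  0.\<close>

context
  fixes M :: "'w \<Rightarrow> complex^'d^'d" and \<omega> :: "nat \<Rightarrow> 'w"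
  assumes M_stochastic: "\<And>k. 1 \<le> k \<Longrightarrow> M (\<omega> k) \<in> stochastic_matrices"
begin

lemma matrix_product_stochastic: "matrix_product M n \<omega> \<in> stochastic_matrices"
  by (induction n) (auto simp: mat_1_stochastic intro!: matrix_mult_stochastic M_stochastic)

lemma mono_col_min: "mono (\<lambda>n. col_min (matrix_product M n \<omega>) j)"
  by (rule incseq_SucI) (simp add: col_mult_stochastic M_stochastic)

lemma antimono_col_max: "antimono (\<lambda>n. col_max (matrix_product M n \<omega>) j)"
proof (rule decseq_SucI)
  fix n
  have "0 \<le> min_entry (M (\<omega> (Suc n))) *
      (col_max (matrix_product M n \<omega>) j - col_min (matrix_product M n \<omega>) j)"
    by (intro mult_nonneg_nonneg min_entry_stochastic M_stochastic) (auto simp: col_min_le_col_max)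
  then show "col_max (matrix_product M (Suc n) \<omega>) j \<le> col_max (matrix_product M n \<omega>) j"
    using col_mult_stochastic(2)[OF M_stochastic, of "Suc n" "matrix_product M n \<omega>" j] by simp
qed

text \<open>Both sides are compared at the later of the two times. Allowing different times makes
  every column maximum an upper bound for the whole sequence of minima, hence for
  \<open>limit_row\<close>.\<close>

lemma col_min_le_col_max_product:
  "col_min (matrix_product M m \<omega>) j \<le> col_max (matrix_product M n \<omega>) j"
proof -
  have "col_min (matrix_product M m \<omega>) j \<le> col_min (matrix_product M (max m n) \<omega>) j"
    using mono_col_min by (rule monoD) simp
  also have "\<dots> \<le> col_max (matrix_product M (max m n) \<omega>) j"
    by (rule col_min_le_col_max)
  also have "\<dots> \<le> col_max (matrix_product M n \<omega>) j"
    using antimono_col_max by (rule antimonoD) simp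
  finally show ?thesis .
qed

lemma bdd_above_col_min: "bdd_above (range (\<lambda>n. col_min (matrix_product M n \<omega>) j))"
proof (rule bdd_aboveI)
  show "x \<le> col_max (matrix_product M 0 \<omega>) j" if "x \<in> range (\<lambda>n. col_min (matrix_product M n \<omega>) j)" for x
    using that by (elim rangeE) (simp only: col_min_le_col_max_product)
qed

text \<open>Each new factor multiplies the spread by at most \<open>1 - min_entry\<close>. The
  induction starts at the identity matrix, whose column spread is at most 1, the value of the empty
  product.\<close>

lemma col_spread_le:
  "col_max (matrix_product M n \<omega>) j - col_min (matrix_product M n \<omega>) j
    \<le> (\<Prod>k=1..n. 1 - min_entry (M (\<omega> k)))"
proof (induction n)
  case 0
  then show ?case
    by (simp add: col_spread_mat_1)
next
  case (Suc n)
  let ?B = "matrix_product M n \<omega>" and ?m = "min_entry (M (\<omega> (Suc n)))"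
  have "col_max (matrix_product M (Suc n) \<omega>) j - col_min (matrix_product M (Suc n) \<omega>) j
      \<le> (1 - ?m) * (col_max ?B j - col_min ?B j)"
    using col_mult_stochastic[OF M_stochastic, of "Suc n" ?B j] by (simp add: algebra_simps)
  also have "\<dots> \<le> (1 - ?m) * (\<Prod>k=1..n. 1 - min_entry (M (\<omega> k)))"
    using min_entry_stochastic(2)[OF M_stochastic, of "Suc n"] by (intro mult_left_mono Suc.IH) auto
  finally show ?case
    by (simp add: mult.commute)
qed

text \<open>The entry and the limit both lie between the column minimum and maximum at time
  \<open>n\<close>, so their distance is at most the spread.\<close>

lemma entry_limit_row_diff:
  "\<bar>Re (matrix_product M n \<omega> $ i $ j) - limit_row M \<omega> j\<bar> \<le> (\<Prod>k=1..n. 1 - min_entry (M (\<omega> k)))"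
proof -
  have "col_min (matrix_product M n \<omega>) j \<le> limit_row M \<omega> j"
    unfolding limit_row_def by (rule cSUP_upper) (auto intro: bdd_above_col_min)
  moreover have "limit_row M \<omega> j \<le> col_max (matrix_product M n \<omega>) j"
    unfolding limit_row_def by (rule cSUP_least) (auto intro: col_min_le_col_max_product)
  ultimately show ?thesis
    using col_bounds[where A="matrix_product M n \<omega>" and i=i and j=j] col_spread_le[of n j] by linarith
qed

text \<open>The entrywise error bound is turned into an operator norm bound at the crude cost of
  \<open>d^2\<close>: one factor \<open>d\<close> from summing over the columns, one from bounding
  the Euclidean norm by the sum of the moduli of the components.\<close>

lemma onorm_matrix_product_diff:
  fixes \<eta> :: "complex^'d"
  assumes \<eta>: "\<And>j. \<eta> $ j = of_real (sqrt (real CARD('d)) * limit_row M \<omega> j)"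
  shows "onorm (\<lambda>v. matrix_product M n \<omega> *v v - ketbra psi_S \<eta> v)
    \<le> (real CARD('d))\<^sup>2 * (\<Prod>k=1..n. 1 - min_entry (M (\<omega> k)))"
proof (rule onorm_le)
  fix v :: "complex^'d"
  let ?\<Phi> = "matrix_product M n \<omega>" and ?X = "\<Prod>k=1..n. 1 - min_entry (M (\<omega> k))"
  \<comment> \<open>The product is non-negative because it dominates an absolute value.\<close>
  have X0: "0 \<le> ?X"
    using entry_limit_row_diff[of n] abs_ge_zero order_trans by blast
  have entry: "norm (?\<Phi> $ i $ j - of_real (limit_row M \<omega> j)) \<le> ?X" for i j
  proof -
    have "?\<Phi> $ i $ j - of_real (limit_row M \<omega> j) = of_real (Re (?\<Phi> $ i $ j) - limit_row M \<omega> j)"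
      by (simp add: complex_eq_iff stochastic_matrixD[OF matrix_product_stochastic])
    then show ?thesis
      using entry_limit_row_diff[of n i j] by (simp only: norm_of_real)
  qed
  \<comment> \<open>The factor \<open>sqrt d\<close> in \<eta> cancels the normalisation of
    \<open>psi_S\<close>, and conjugation does nothing since \<eta> has real entries.\<close>
  have ketbra: "ketbra psi_S \<eta> v $ i = (\<Sum>j\<in>UNIV. of_real (limit_row M \<omega> j) * v $ j)" for i
    by (simp add: ketbra_def psi_S_def hermitian_inner_def \<eta> sum_divide_distrib)
  have comp: "norm ((?\<Phi> *v v - ketbra psi_S \<eta> v) $ i) \<le> real CARD('d) * (?X * norm v)" for i
  proof -
    have "(?\<Phi> *v v - ketbra psi_S \<eta> v) $ i = (\<Sum>j\<in>UNIV. (?\<Phi> $ i $ j - of_real (limit_row M \<omega> j)) * v $ j)"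
      by (simp add: ketbra matrix_vector_mult_def left_diff_distrib sum_subtractf)
    also have "norm \<dots> \<le> (\<Sum>j\<in>(UNIV::'d set). ?X * norm v)"
      by (intro sum_norm_le order_trans[OF norm_mult_ineq] mult_mono entry X0 Finite_Cartesian_Product.norm_nth_le norm_ge_zero)
    finally show ?thesis
      by simp
  qed
  have "norm (?\<Phi> *v v - ketbra psi_S \<eta> v) \<le> (\<Sum>i\<in>UNIV. norm ((?\<Phi> *v v - ketbra psi_S \<eta> v) $ i))"
    unfolding norm_vec_def[of "?\<Phi> *v v - ketbra psi_S \<eta> v"] by (rule L2_set_le_sum) simp
  also have "\<dots> \<le> (\<Sum>i\<in>(UNIV::'d set). real CARD('d) * (?X * norm v))"
    by (intro sum_mono comp)
  finally show "norm (?\<Phi> *v v - ketbra psi_S \<eta> v) \<le> (real CARD('d))\<^sup>2 * ?X * norm v"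
    by (simp add: power2_eq_square mult_ac)
qed

end

subsection \<open>Measurability\<close>

lemma measurable_Re_entry [measurable]:
  assumes [measurable]: "M \<in> borel_measurable p"
  shows "(\<lambda>x. Re ((M x :: complex^'d^'d) $ i $ j)) \<in> borel_measurable p"
proof -
  have "(\<lambda>A :: complex^'d^'d. Re (A $ i $ j)) \<in> borel_measurable borel"
    by (intro borel_measurable_continuous_onI continuous_intros)
  from measurable_compose[OF assms this] show ?thesis .
qed

lemma measurable_min_entry [measurable]:
  assumes [measurable]: "M \<in> borel_measurable p"
  shows "(\<lambda>x. min_entry (M x :: complex^'d^'d)) \<in> borel_measurable p"
  unfolding min_entry_def by (auto intro!: borel_measurable_Min)

lemma measurable_component_iid:
  assumes "1 \<le> k" "f \<in> measurable p N"
  shows "(\<lambda>\<omega>. f (\<omega> k)) \<in> measurable (iid_sequence_space p) N"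
  unfolding iid_sequence_space_def
  using assms by (intro measurable_compose[where g=f, OF measurable_component_singleton]) auto

lemma iid_sequence_spaceD: "\<omega> \<in> space (iid_sequence_space p) \<Longrightarrow> 1 \<le> k \<Longrightarrow> \<omega> k \<in> space p"
  by (auto simp: iid_sequence_space_def space_PiM)

lemma measurable_matrix_product [measurable]:
  fixes M :: "'w \<Rightarrow> complex^'d^'d"
  assumes "M \<in> borel_measurable p"
  shows "matrix_product M n \<in> borel_measurable (iid_sequence_space p)"
proof (induction n)
  case 0
  have "matrix_product M 0 = (\<lambda>\<omega>. mat 1)"
    by (rule ext) simp
  then show ?case
    by simp
next
  case (Suc n)
  have "continuous_on UNIV (\<lambda>x. fst x ** (snd x :: complex^'d^'d))"
    unfolding matrix_matrix_mult_def by (intro continuous_intros)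
  from borel_measurable_continuous_Pair[OF measurable_component_iid[OF _ assms] Suc this, of "Suc n"]
  have "(\<lambda>\<omega>. M (\<omega> (Suc n)) ** matrix_product M n \<omega>) \<in> borel_measurable (iid_sequence_space p)"
    by simp
  moreover have "matrix_product M (Suc n) = (\<lambda>\<omega>. M (\<omega> (Suc n)) ** matrix_product M n \<omega>)"
    by (rule ext) simp
  ultimately show ?case
    by simp
qed

text \<open>A pointwise bounded countable supremum of measurable functions is measurable;
  boundedness holds on the sequence space because all coordinates from 1 on lie in
  \<open>space p\<close>.\<close>

lemma measurable_limit_row:
  fixes M :: "'w \<Rightarrow> complex^'d^'d"
  assumes [measurable]: "M \<in> borel_measurable p"
    and "\<And>x. x \<in> space p \<Longrightarrow> M x \<in> stochastic_matrices"
  shows "(\<lambda>\<omega>. limit_row M \<omega> j) \<in> borel_measurable (iid_sequence_space p)"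
  unfolding limit_row_def
proof (rule borel_measurable_cSUP)
  show "(\<lambda>\<omega>. col_min (matrix_product M n \<omega>) j) \<in> borel_measurable (iid_sequence_space p)" for n
    unfolding col_min_def by measurable
  show "bdd_above (range (\<lambda>n. col_min (matrix_product M n \<omega>) j))"
    if "\<omega> \<in> space (iid_sequence_space p)" for \<omega>
    by (intro bdd_above_col_min assms(2) iid_sequence_spaceD[OF that])
qed simp

subsection \<open>Products of independent contraction factors\<close>

lemma prob_space_iid_sequence_space: "prob_space p \<Longrightarrow> prob_space (iid_sequence_space p)"
  unfolding iid_sequence_space_def by (rule prob_space_PiM)

text \<open>The integrand depends on the first \<open>n\<close> coordinates only, so the infinite
  product measure can be replaced by its projection to \<open>{1..n}\<close>, where the integral of
  the product factorises.\<close>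

lemma nn_integral_prod_iid:
  assumes "prob_space p" and f [measurable]: "f \<in> borel_measurable p"
  shows "(\<integral>\<^sup>+\<omega>. (\<Prod>k=1..n. f (\<omega> k)) \<partial>iid_sequence_space p) = (\<integral>\<^sup>+x. f x \<partial>p) ^ n"
proof -
  interpret prob_space p by fact
  interpret product_prob_space "\<lambda>_. p" "{1::nat..}" ..
  have "(\<integral>\<^sup>+x. f x \<partial>p) ^ n = (\<Prod>k=1..n. \<integral>\<^sup>+x. f x \<partial>p)"
    by simp
  also have "\<dots> = (\<integral>\<^sup>+\<omega>. (\<Prod>k=1..n. f (\<omega> k)) \<partial>(\<Pi>\<^sub>M k\<in>{1..n}. p))"
    by (rule product_nn_integral_prod[symmetric]) auto
  also have "\<dots> = (\<integral>\<^sup>+\<omega>. (\<Prod>k=1..n. f (\<omega> k))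
      \<partial>distr (iid_sequence_space p) (\<Pi>\<^sub>M k\<in>{1..n}. p) (\<lambda>\<omega>. restrict \<omega> {1..n}))"
    unfolding iid_sequence_space_def by (subst distr_PiM_restrict_finite) auto
  also have "\<dots> = (\<integral>\<^sup>+\<omega>. (\<Prod>k=1..n. f (restrict \<omega> {1..n} k)) \<partial>iid_sequence_space p)"
    unfolding iid_sequence_space_def
    by (rule nn_integral_distr) (auto intro!: measurable_restrict_subset)
  also have "\<dots> = (\<integral>\<^sup>+\<omega>. (\<Prod>k=1..n. f (\<omega> k)) \<partial>iid_sequence_space p)"
    by (intro nn_integral_cong prod.cong) auto
  finally show ?thesis ..
qed

lemma AE_exponential_decay_prod_iid:
  fixes f :: "'w \<Rightarrow> real"
  assumes p: "prob_space p" and f [measurable]: "f \<in> borel_measurable p"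
    and f0: "\<And>x. x \<in> space p \<Longrightarrow> 0 \<le> f x" and int: "(\<integral>\<^sup>+x. f x \<partial>p) < 1"
  obtains \<alpha> where "0 < \<alpha>"
    and "AE \<omega> in iid_sequence_space p. \<exists>C. \<forall>n. (\<Prod>k=1..n. f (\<omega> k)) \<le> C * exp (- \<alpha> * real n)"
proof -
  let ?P = "iid_sequence_space p"
  obtain \<rho> where \<rho>: "(\<integral>\<^sup>+x. f x \<partial>p) = ennreal \<rho>" "0 \<le> \<rho>" "\<rho> < 1"
    using int by (cases "\<integral>\<^sup>+x. f x \<partial>p") auto
  \<comment> \<open>The reciprocal of the midpoint of \<rho> and 1, which gives both strict
    inequalities below, also when \<rho> is 0.\<close>
  define \<beta> where "\<beta> = 2 / (1 + \<rho>)"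
  have \<beta>: "1 < \<beta>" "\<beta> * \<rho> < 1" "0 \<le> \<beta> * \<rho>"
    using \<rho> by (auto simp: \<beta>_def field_simps)
  define g where "g n \<omega> = \<beta> ^ n * (\<Prod>k=1..n. f (\<omega> k))" for n and \<omega> :: "nat \<Rightarrow> 'w"
  have [measurable]: "g n \<in> borel_measurable ?P" for n
    unfolding g_def by (intro borel_measurable_times borel_measurable_prod measurable_component_iid f) auto
  have prod0: "0 \<le> (\<Prod>k=1..n. f (\<omega> k))" if "\<omega> \<in> space ?P" for n \<omega>
    by (intro prod_nonneg f0 iid_sequence_spaceD[OF that] ballI) auto
  have g_int: "(\<integral>\<^sup>+\<omega>. g n \<omega> \<partial>?P) = ennreal ((\<beta> * \<rho>) ^ n)" for n
  proof -
    have "(\<integral>\<^sup>+\<omega>. g n \<omega> \<partial>?P) = (\<integral>\<^sup>+\<omega>. ennreal (\<beta> ^ n) * (\<Prod>k=1..n. ennreal (f (\<omega> k))) \<partial>?P)"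
    proof (rule nn_integral_cong)
      fix \<omega> assume \<omega>: "\<omega> \<in> space ?P"
      then have "(\<Prod>k=1..n. ennreal (f (\<omega> k))) = ennreal (\<Prod>k=1..n. f (\<omega> k))"
        by (intro prod_ennreal f0 iid_sequence_spaceD[OF \<omega>]) auto
      then show "ennreal (g n \<omega>) = ennreal (\<beta> ^ n) * (\<Prod>k=1..n. ennreal (f (\<omega> k)))"
        using \<beta>(1) prod0[OF \<omega>] by (simp add: g_def ennreal_mult)
    qed
    also have "\<dots> = ennreal (\<beta> ^ n) * (\<integral>\<^sup>+\<omega>. (\<Prod>k=1..n. ennreal (f (\<omega> k))) \<partial>?P)"
      by (intro nn_integral_cmult borel_measurable_prod_ennreal measurable_component_iid) auto
    also have "\<dots> = ennreal (\<beta> ^ n) * ennreal \<rho> ^ n"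
      by (subst nn_integral_prod_iid[OF p]) (auto simp: \<rho>)
    also have "\<dots> = ennreal ((\<beta> * \<rho>) ^ n)"
      using \<beta> \<rho> by (simp add: ennreal_power ennreal_mult power_mult_distrib)
    finally show ?thesis .
  qed
  have "(\<integral>\<^sup>+\<omega>. (\<Sum>n. ennreal (g n \<omega>)) \<partial>?P) = (\<Sum>n. ennreal ((\<beta> * \<rho>) ^ n))"
    by (subst nn_integral_suminf) (auto simp: g_int)
  also have "\<dots> = ennreal (\<Sum>n. (\<beta> * \<rho>) ^ n)"
    using \<beta> by (intro suminf_ennreal2 summable_geometric) auto
  \<comment> \<open>The integral is a convergent geometric series, and a non-negative function with
    finite integral is finite almost everywhere.\<close>
  finally have "AE \<omega> in ?P. (\<Sum>n. ennreal (g n \<omega>)) \<noteq> \<infinity>"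
    by (intro nn_integral_PInf_AE) auto
  then have "AE \<omega> in ?P. \<exists>C. \<forall>n. (\<Prod>k=1..n. f (\<omega> k)) \<le> C * exp (- ln \<beta> * real n)"
  proof (rule AE_mp, intro AE_I2 impI)
    fix \<omega> assume \<omega>: "\<omega> \<in> space ?P" and fin: "(\<Sum>n. ennreal (g n \<omega>)) \<noteq> \<infinity>"
    have g0: "0 \<le> g n \<omega>" for n
      using prod0[OF \<omega>] \<beta>(1) by (simp add: g_def)
    then have "summable (\<lambda>n. g n \<omega>)"
      using fin by (intro summable_suminf_not_top) auto
    \<comment> \<open>One non-negative term is at most the whole series, so the sum of the series
      serves as the constant \<open>C\<close>, and \<open>ln \<beta>\<close> as the rate.\<close>
    then have "g n \<omega> \<le> (\<Sum>n. g n \<omega>)" for n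
      using sum_le_suminf[of "\<lambda>n. g n \<omega>" "{n}"] g0 by simp
    moreover have "exp (- ln \<beta> * real n) = inverse (\<beta> ^ n)" for n
      using \<beta>(1) by (simp add: exp_minus exp_of_nat2_mult)
    ultimately have "(\<Prod>k=1..n. f (\<omega> k)) \<le> (\<Sum>n. g n \<omega>) * exp (- ln \<beta> * real n)" for n
      using \<beta>(1) by (simp add: g_def inverse_eq_divide pos_le_divide_eq mult.commute)
    then show "\<exists>C. \<forall>n. (\<Prod>k=1..n. f (\<omega> k)) \<le> C * exp (- ln \<beta> * real n)"
      by blast
  qed
  with \<beta>(1) show thesis
    by (intro that[of "ln \<beta>"]) auto
qed

text \<open>If the expectation of \<open>min_entry\<close> were 0, then \<open>min_entry\<close>
  would vanish almost everywhere, whereas it is positive on the strictly positive matrices, which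
  occur with positive probability.\<close>

lemma nn_integral_contraction_less_1:
  fixes M :: "'w \<Rightarrow> complex^'d^'d"
  assumes "prob_space p" and M [measurable]: "M \<in> borel_measurable p"
    and stoch: "\<And>x. x \<in> space p \<Longrightarrow> M x \<in> stochastic_matrices"
    and pos: "measure p {x \<in> space p. M x \<in> positive_stochastic_matrices} > 0"
  shows "(\<integral>\<^sup>+x. ennreal (1 - min_entry (M x)) \<partial>p) < 1"
proof -
  interpret prob_space p by fact
  have bounds: "0 \<le> min_entry (M x)" "min_entry (M x) \<le> 1" if "x \<in> space p" for x
    using min_entry_stochastic[OF stoch[OF that]] by auto
  have int: "integrable p (\<lambda>x. min_entry (M x))"
    by (rule integrable_const_bound[of _ 1]) (auto simp: bounds)
  have "\<not> (AE x in p. min_entry (M x) = 0)"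
  proof
    assume "AE x in p. min_entry (M x) = 0"
    then have "AE x in p. M x \<notin> positive_stochastic_matrices"
      by (rule AE_mp, intro AE_I2) (auto dest: min_entry_positive)
    \<comment> \<open>The event is measurable because its measure is positive:
      \<open>measure\<close> is 0 on sets outside the \<sigma>-algebra.\<close>
    moreover have "{x \<in> space p. M x \<in> positive_stochastic_matrices} \<in> sets p"
      using pos measure_notin_sets by fastforce
    ultimately have "measure p {x \<in> space p. M x \<in> positive_stochastic_matrices} = 0"
      by (subst (asm) prob_Collect_eq_0[symmetric]) auto
    with pos show False
      by simp
  qed
  then have "(\<integral>x. min_entry (M x) \<partial>p) \<noteq> 0"
    using integral_nonneg_eq_0_iff_AE[OF int] bounds by auto
  moreover have "0 \<le> (\<integral>x. min_entry (M x) \<partial>p)"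
    by (rule integral_nonneg_AE) (auto simp: bounds)
  ultimately have "(\<integral>x. 1 - min_entry (M x) \<partial>p) < 1"
    using int by (simp add: prob_space)
  moreover have "(\<integral>\<^sup>+x. ennreal (1 - min_entry (M x)) \<partial>p) = ennreal (\<integral>x. 1 - min_entry (M x) \<partial>p)"
    using int by (intro nn_integral_eq_integral) (auto simp: bounds)
  ultimately show ?thesis
    by (simp add: ennreal_less_one_iff)
qed

section \<open>The random rank-one limit and its exponential rate\<close>

theorem theorem4:
  fixes p :: "'w measure" and M :: "'w \<Rightarrow> complex^'d^'d"
  assumes "prob_space p"
    and "M \<in> borel_measurable p"
    and "\<And>\<omega>. \<omega> \<in> space p \<Longrightarrow> M \<omega> \<in> stochastic_matrices"
    and "measure p {\<omega> \<in> space p. M \<omega> \<in> positive_stochastic_matrices} > 0"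
  shows "\<exists>\<alpha>>0. \<exists>\<Omega>\<^sub>4 \<in> sets (iid_sequence_space p). \<exists>\<eta> \<in> borel_measurable (iid_sequence_space p).
    measure (iid_sequence_space p) \<Omega>\<^sub>4 = 1 \<and>
    (\<forall>\<omega>\<in>\<Omega>\<^sub>4. \<exists>C. \<forall>n\<ge>1.
      onorm (\<lambda>v. matrix_product M n \<omega> *v v - ketbra psi_S (\<eta> \<omega>) v)
        \<le> C * exp (- \<alpha> * real n))"
proof -
  let ?P = "iid_sequence_space p" and ?d = "real CARD('d)"
  interpret P: prob_space ?P
    using assms(1) by (rule prob_space_iid_sequence_space)
  obtain \<alpha> where \<alpha>: "0 < \<alpha>"
    and decay: "AE \<omega> in ?P. \<exists>C. \<forall>n. (\<Prod>k=1..n. 1 - min_entry (M (\<omega> k))) \<le> C * exp (- \<alpha> * real n)"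
  proof (rule AE_exponential_decay_prod_iid[OF assms(1)])
    show "(\<lambda>x. 1 - min_entry (M x)) \<in> borel_measurable p"
      using measurable_min_entry[OF assms(2)] by simp
    show "0 \<le> 1 - min_entry (M x)" if "x \<in> space p" for x
      using min_entry_stochastic(2)[OF assms(3)[OF that]] by simp
  qed (use nn_integral_contraction_less_1[OF assms] in auto)
  \<comment> \<open>Passing from almost everywhere to an actual measurable set of probability 1 that
    stays inside \<open>space ?P\<close>.\<close>
  from decay obtain \<Omega>\<^sub>4 where \<Omega>\<^sub>4: "\<Omega>\<^sub>4 \<in> sets ?P" "measure ?P \<Omega>\<^sub>4 = 1"
    "\<Omega>\<^sub>4 \<subseteq> {\<omega> \<in> space ?P. \<exists>C. \<forall>n. (\<Prod>k=1..n. 1 - min_entry (M (\<omega> k))) \<le> C * exp (- \<alpha> * real n)}"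
    by (rule P.AE_E_prob)
  \<comment> \<open>Writing the vector in the standard basis reduces its measurability to that of
    the real functions \<open>limit_row\<close>.\<close>
  define \<eta> :: "(nat \<Rightarrow> 'w) \<Rightarrow> complex^'d" where
    "\<eta> \<omega> = (\<Sum>j\<in>UNIV. (sqrt ?d * limit_row M \<omega> j) *\<^sub>R axis j 1)" for \<omega>
  have \<eta>_meas: "\<eta> \<in> borel_measurable ?P"
    unfolding \<eta>_def
    by (intro borel_measurable_sum borel_measurable_scaleR borel_measurable_times
        measurable_limit_row assms(2,3)) auto
  have \<eta>_nth: "\<eta> \<omega> $ j = of_real (sqrt ?d * limit_row M \<omega> j)" for \<omega> j
    by (simp add: \<eta>_def axis_def of_real_def if_distrib[of "(*\<^sub>R) _"] cong: if_cong)
  have "\<exists>C. \<forall>n\<ge>1. onorm (\<lambda>v. matrix_product M n \<omega> *v v - ketbra psi_S (\<eta> \<omega>) v)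
      \<le> C * exp (- \<alpha> * real n)" if "\<omega> \<in> \<Omega>\<^sub>4" for \<omega>
  proof -
    from that \<Omega>\<^sub>4(3) obtain C where \<omega>: "\<omega> \<in> space ?P"
      and C: "\<And>n. (\<Prod>k=1..n. 1 - min_entry (M (\<omega> k))) \<le> C * exp (- \<alpha> * real n)"
      by blast
    \<comment> \<open>The constant depends on the sequence through \<open>C\<close> alone; the rate
      \<alpha> is common to all sequences.\<close>
    have "onorm (\<lambda>v. matrix_product M n \<omega> *v v - ketbra psi_S (\<eta> \<omega>) v)
        \<le> ?d\<^sup>2 * C * exp (- \<alpha> * real n)" for n
    proof -
      have "onorm (\<lambda>v. matrix_product M n \<omega> *v v - ketbra psi_S (\<eta> \<omega>) v)
          \<le> ?d\<^sup>2 * (\<Prod>k=1..n. 1 - min_entry (M (\<omega> k)))"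
        by (intro onorm_matrix_product_diff assms(3) iid_sequence_spaceD[OF \<omega>] \<eta>_nth)
      also have "\<dots> \<le> ?d\<^sup>2 * (C * exp (- \<alpha> * real n))"
        by (intro mult_left_mono C) simp
      finally show ?thesis
        by (simp add: mult.assoc)
    qed
    then show ?thesis
      by blast
  qed
  with \<alpha> \<Omega>\<^sub>4(1,2) \<eta>_meas show ?thesis
    by blast
qed

end
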